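(* A minimal dynamical system $(X,T)$ is pairwise IP$^*$-equicontinuous if and only if it is distal.
   Context: A dynamical system is a pair $(X,T)$ where $X$ is a compact metric space with metric $d$ and $T\colon X\to X$ is a continuous surjection. $\mathbb{N}$ is the set of positive integers. A subsystem is a non-empty closed $Y\subset X$ with $TY\subset Y$; a system is minimal if it has no proper subsystem. A pair $(x,y)\in X^2$ is proximal if $\liminf_{k\to\infty}d(T^kx,T^ky)=0$, and distal otherwise. $(X,T)$ is distal if every pair of distinct points of $X$ is distal. A set $F\subset\mathbb{N}$ is an IP-set if there is a sequence $(p_i)_{i\ge1}$ in $\mathbb{N}$ such that $\sum_{i\in\alpha}p_i\in F$ for every non-empty finite $\alpha\subset\mathbb{N}$; it is an IP$^*$-set if it meets every IP-set. A point $x\in X$ is pairwise IP$^*$-equicontinuous if for every $\varepsilon>0$ there is a neighbourhood $U$ of $x$ such that for all $y,z\in U$, $\{k\in\mathbb{N}:d(T^ky,T^kz)<\varepsilon\}$ is an IP$^*$-set. $(X,T)$ is pairwise IP$^*$-equicontinuous if every point of $X$ is pairwise IP$^*$-equicontinuous. *)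

theory Defs
  imports "HOL-Analysis.Analysis"
begin

text \<open>
  A compact metric space is a compact subset \<open>X\<close> of a type of class \<open>metric_space\<close>, with
  the metric \<open>dist\<close>. The map \<open>T\<close> is a total function on that type; only its values on \<open>X\<close>
  matter, and topological notions are relative to \<open>X\<close>.
\<close>

definition dynamical_system :: "'a::metric_space set \<Rightarrow> ('a \<Rightarrow> 'a) \<Rightarrow> bool" where
  "dynamical_system X T \<longleftrightarrow> compact X \<and> continuous_on X T \<and> T ` X = X"

text \<open>A subsystem is only required to be forward invariant: \<open>T ` Y = Y\<close> is not demanded.\<close>

definition subsystem :: "'a::metric_space set \<Rightarrow> ('a \<Rightarrow> 'a) \<Rightarrow> 'a set \<Rightarrow> bool" where
  "subsystem X T Y \<longleftrightarrow> Y \<noteq> {} \<and> closedin (top_of_set X) Y \<and> T ` Y \<subseteq> Y"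

definition minimal_system :: "'a::metric_space set \<Rightarrow> ('a \<Rightarrow> 'a) \<Rightarrow> bool" where
  "minimal_system X T \<longleftrightarrow> dynamical_system X T \<and> \<not> (\<exists>Y. subsystem X T Y \<and> Y \<subset> X)"

text \<open>The lower limit is taken in \<open>ereal\<close>, a complete lattice.\<close>

definition proximal_pair :: "('a::metric_space \<Rightarrow> 'a) \<Rightarrow> 'a \<Rightarrow> 'a \<Rightarrow> bool" where
  "proximal_pair T x y \<longleftrightarrow> liminf (\<lambda>k. ereal (dist ((T ^^ k) x) ((T ^^ k) y))) = 0"

definition distal_pair :: "('a::metric_space \<Rightarrow> 'a) \<Rightarrow> 'a \<Rightarrow> 'a \<Rightarrow> bool" where
  "distal_pair T x y \<longleftrightarrow> \<not> proximal_pair T x y"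

definition distal_system :: "'a::metric_space set \<Rightarrow> ('a \<Rightarrow> 'a) \<Rightarrow> bool" where
  "distal_system X T \<longleftrightarrow> (\<forall>x\<in>X. \<forall>y\<in>X. x \<noteq> y \<longrightarrow> distal_pair T x y)"

text \<open>The positive integers are \<open>{1..} :: nat set\<close>; the value \<open>p 0\<close> below is irrelevant.\<close>

definition IP_set :: "nat set \<Rightarrow> bool" where
  "IP_set F \<longleftrightarrow> F \<subseteq> {1..} \<and>
     (\<exists>p :: nat \<Rightarrow> nat. (\<forall>i\<ge>1. p i \<ge> 1) \<and>
       (\<forall>\<alpha>. finite \<alpha> \<and> \<alpha> \<noteq> {} \<and> \<alpha> \<subseteq> {1..} \<longrightarrow> (\<Sum>i\<in>\<alpha>. p i) \<in> F))"

definition IP_star_set :: "nat set \<Rightarrow> bool" where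
  "IP_star_set F \<longleftrightarrow> F \<subseteq> {1..} \<and> (\<forall>A. IP_set A \<longrightarrow> F \<inter> A \<noteq> {})"

definition pairwise_IP_star_equicontinuous_at ::
    "'a::metric_space set \<Rightarrow> ('a \<Rightarrow> 'a) \<Rightarrow> 'a \<Rightarrow> bool" where
  "pairwise_IP_star_equicontinuous_at X T x \<longleftrightarrow>
     (\<forall>\<epsilon>>0. \<exists>U. openin (top_of_set X) U \<and> x \<in> U \<and>
       (\<forall>y\<in>U. \<forall>z\<in>U. IP_star_set {k. k \<ge> 1 \<and> dist ((T ^^ k) y) ((T ^^ k) z) < \<epsilon>}))"

definition pairwise_IP_star_equicontinuous ::
    "'a::metric_space set \<Rightarrow> ('a \<Rightarrow> 'a) \<Rightarrow> bool" where
  "pairwise_IP_star_equicontinuous X T \<longleftrightarrow>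
     (\<forall>x\<in>X. pairwise_IP_star_equicontinuous_at X T x)"

end

theory Submission
  imports Defs
begin

text \<open>
  If the system is distal and \<open>p\<close> generates an IP-set, the Ellis--Numakura lemma yields an
  idempotent \<open>u\<close> among the limits of the maps \<open>T ^^ (\<Sum>i\<in>\<alpha>. p i)\<close>. Since \<open>u (u x) = u x\<close>, the pair
  \<open>(x, u x)\<close> is proximal, so \<open>u x = x\<close>: finitely many points return close to themselves
  at a common time in any given IP-set.

  Conversely, if \<open>x \<noteq> y\<close> are proximal in a minimal system, then both orbits enter every
  neighbourhood of \<open>x\<close> simultaneously, first at one time (syndetic returns of \<open>x\<close> meet times of
  proximity), then, by choosing generators one after the other, along an IP-set. By minimality some
  \<open>(T ^^ k) x\<close> is near \<open>y\<close>, and along that IP-set \<open>y\<close> and \<open>(T ^^ k) x\<close> are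
  carried near \<open>x\<close> and \<open>(T ^^ k) x\<close>, which lie far apart.
\<close>

section \<open>Separation in the pointwise topology on functions\<close>

lemma open_coordinate_vimage: "open W \<Longrightarrow> open ((\<lambda>f. f i) -` W)"
  by (intro open_vimage continuous_on_product_coordinates)

instance "fun" :: (type, t0_space) t0_space
proof
  fix f g :: "'a \<Rightarrow> 'b"
  assume "f \<noteq> g"
  then obtain i where i: "f i \<noteq> g i" by auto
  obtain U where "open U" "\<not> (f i \<in> U \<longleftrightarrow> g i \<in> U)"
    using iffD1[OF separation_t0 i] by (elim exE conjE) (rule that)
  then show "\<exists>U. open U \<and> \<not> (f \<in> U \<longleftrightarrow> g \<in> U)"
    by (intro exI[of _ "(\<lambda>h. h i) -` U"]) (auto simp: open_coordinate_vimage)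
qed

instance "fun" :: (type, t1_space) t1_space
proof
  fix f g :: "'a \<Rightarrow> 'b"
  assume "f \<noteq> g"
  then obtain i where i: "f i \<noteq> g i" by auto
  obtain U where "open U" "f i \<in> U" "g i \<notin> U"
    using t1_space[OF i] by blast
  then show "\<exists>U. open U \<and> f \<in> U \<and> g \<notin> U"
    by (intro exI[of _ "(\<lambda>h. h i) -` U"]) (auto simp: open_coordinate_vimage)
qed

text \<open>Lets \<open>ellis_numakura\<close> be applied to sets of maps, and makes compact sets of
  maps closed. Any coordinate at which two maps differ separates them.\<close>

instance "fun" :: (type, t2_space) t2_space
proof
  fix f g :: "'a \<Rightarrow> 'b"
  assume "f \<noteq> g"
  then obtain i where i: "f i \<noteq> g i" by auto
  obtain U V where "open U" "open V" "f i \<in> U" "g i \<in> V" "U \<inter> V = {}"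
    using hausdorff[OF i] by blast
  then show "\<exists>U V. open U \<and> open V \<and> f \<in> U \<and> g \<in> V \<and> U \<inter> V = {}"
    by (intro exI[of _ "(\<lambda>h. h i) -` U"] exI[of _ "(\<lambda>h. h i) -` V"])
      (auto simp: open_coordinate_vimage)
qed

section \<open>Idempotents in compact semigroups\<close>

text \<open>Zorn's lemma gives a minimal closed subsemigroup \<open>M\<close>. For \<open>e\<close>
  in \<open>M\<close>, the right multiples \<open>m a e\<close> form a closed subsemigroup, hence
  all of \<open>M\<close>, so some \<open>a\<close> satisfies \<open>m a e = e\<close>. The set of
  such \<open>a\<close> is again a closed subsemigroup, so it equals \<open>M\<close> and contains
  \<open>e\<close> itself.\<close>

lemma ellis_numakura:
  fixes S :: "'b::t2_space set" and m :: "'b \<Rightarrow> 'b \<Rightarrow> 'b"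
  assumes S: "compact S" "S \<noteq> {}"
    and clo: "\<And>a b. a \<in> S \<Longrightarrow> b \<in> S \<Longrightarrow> m a b \<in> S"
    and assoc: "\<And>a b c. a \<in> S \<Longrightarrow> b \<in> S \<Longrightarrow> c \<in> S \<Longrightarrow> m (m a b) c = m a (m b c)"
    and cont: "\<And>b. b \<in> S \<Longrightarrow> continuous_on S (\<lambda>a. m a b)"
  obtains e where "e \<in> S" "m e e = e"
proof -
  define \<A> where
    "\<A> = {A. A \<noteq> {} \<and> closed A \<and> A \<subseteq> S \<and> (\<forall>a\<in>A. \<forall>b\<in>A. m a b \<in> A)}"
  have "\<exists>M\<in>\<A>. \<forall>A\<in>\<A>. A \<subseteq> M \<longrightarrow> A = M"
  proof (rule predicate_Zorn)
    show "partial_order_on \<A> (relation_of (\<lambda>A B. B \<subseteq> A) \<A>)"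
      by (auto simp: partial_order_on_def preorder_on_def refl_on_def trans_def antisym_def
          relation_of_def)
  next
    fix \<C> assume \<C>: "\<C> \<in> Chains (relation_of (\<lambda>A B. B \<subseteq> A) \<A>)"
    have sub: "\<C> \<subseteq> \<A>" and chain: "\<And>A B. A \<in> \<C> \<Longrightarrow> B \<in> \<C> \<Longrightarrow> A \<subseteq> B \<or> B \<subseteq> A"
      using \<C> unfolding Chains_def relation_of_def by auto
    \<comment> \<open>The chain is bounded by its intersection, cut with \<open>S\<close> so that
      the empty chain has a bound too. A non-empty finite subfamily has a least member, so
      compactness applies.\<close>
    have "S \<inter> \<Inter>\<C> \<noteq> {}"
    proof (rule compact_imp_fip[OF S(1)])
      show "closed A" if "A \<in> \<C>" for A using that sub by (auto simp: \<A>_def)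
    next
      fix \<F> assume \<F>: "finite \<F>" "\<F> \<subseteq> \<C>"
      show "S \<inter> \<Inter>\<F> \<noteq> {}"
      proof (cases "\<F> = {}")
        case False
        then obtain A where A: "A \<in> \<F>" "\<And>B. B \<in> \<F> \<Longrightarrow> B \<subseteq> A \<Longrightarrow> A = B"
          using finite_has_minimal[OF \<F>(1)] by metis
        then have "A \<subseteq> \<Inter>\<F>" using chain \<F>(2) by blast
        moreover have "A \<in> \<A>" using A(1) \<F>(2) sub by auto
        ultimately show ?thesis unfolding \<A>_def by blast
      qed (use S(2) in auto)
    qed
    moreover have "closed S" using S(1) by (rule compact_imp_closed)
    moreover have "closed A" if "A \<in> \<C>" for A
      using that sub by (auto simp: \<A>_def)
    moreover have "m a b \<in> A" if "A \<in> \<C>" "a \<in> \<Inter>\<C>" "b \<in> \<Inter>\<C>" for A a b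
      using that sub unfolding \<A>_def by blast
    ultimately have "S \<inter> \<Inter>\<C> \<in> \<A>"
      using clo unfolding \<A>_def by (simp add: closed_Int closed_Inter)
    then show "\<exists>u\<in>\<A>. \<forall>A\<in>\<C>. u \<subseteq> A"
      by (rule bexI[rotated]) auto
  qed
  then obtain M where M: "M \<in> \<A>" and min: "\<And>A. A \<in> \<A> \<Longrightarrow> A \<subseteq> M \<Longrightarrow> A = M" by blast
  have M': "M \<noteq> {}" "closed M" "M \<subseteq> S" "\<And>a b. a \<in> M \<Longrightarrow> b \<in> M \<Longrightarrow> m a b \<in> M"
    using M by (auto simp: \<A>_def)
  have "compact M"
    using S(1) M'(2,3) compact_Int_closed[of S M] by (simp add: Int_absorb1)
  obtain e where e: "e \<in> M" using M'(1) by blast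
  have conte: "continuous_on M (\<lambda>a. m a e)"
    using cont continuous_on_subset e M'(3) by blast
  have "(\<lambda>a. m a e) ` M = M"
  proof (rule min)
    have "closed ((\<lambda>a. m a e) ` M)"
      using conte \<open>compact M\<close> by (intro compact_imp_closed compact_continuous_image)
    moreover have "m (m a e) (m b e) = m (m (m a e) b) e" if "a \<in> M" "b \<in> M" for a b
      using that e M'(3,4) by (intro assoc[symmetric]) blast+
    ultimately show "(\<lambda>a. m a e) ` M \<in> \<A>"
      using M' e unfolding \<A>_def by (auto simp: image_iff)
  qed (use e M'(4) in auto)
  then obtain a where a: "a \<in> M" "m a e = e" using e by (metis imageE)
  have "{a \<in> M. m a e = e} = M"
  proof (rule min)
    have "closed {a \<in> M. m a e = e}"
      using continuous_closed_preimage[OF conte M'(2) closed_singleton[of e]]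
      by (simp add: vimage_def Int_def)
    moreover have "m (m b c) e = e" if "b \<in> M" "c \<in> M" "m b e = e" "m c e = e" for b c
      using that e M'(3) assoc[of b c e] by auto
    ultimately show "{a \<in> M. m a e = e} \<in> \<A>"
      using a M' unfolding \<A>_def by auto
  qed auto
  then show thesis using that e M'(3) by blast
qed

section \<open>Iterates on a compact invariant set and proximality\<close>

lemma continuous_on_funpow:
  fixes T :: "'a::topological_space \<Rightarrow> 'a"
  assumes "continuous_on X T" "T ` X \<subseteq> X"
  shows "continuous_on X (T ^^ n)"
proof (induction n)
  case (Suc n)
  have "(T ^^ n) ` X \<subseteq> X"
    using assms(2) by (induction n) auto
  then show ?case
    using continuous_on_compose2[OF assms(1) Suc] by (simp add: o_def)
qed (simp add: id_def)

lemma funpow_in: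
  assumes "T ` X \<subseteq> X" "x \<in> X"
  shows "(T ^^ n) x \<in> X"
  using assms by (induction n) auto

text \<open>Each iterate is uniformly continuous on the compact \<open>X\<close>; the least of
  finitely many moduli serves all times up to \<open>N\<close>.\<close>

lemma equicontinuous_funpow_upto:
  fixes T :: "'a::metric_space \<Rightarrow> 'a"
  assumes "compact X" "continuous_on X T" "T ` X \<subseteq> X" "e > 0"
  obtains d where "d > 0"
    "\<And>x y n. x \<in> X \<Longrightarrow> y \<in> X \<Longrightarrow> n \<le> N \<Longrightarrow> dist x y < d \<Longrightarrow> dist ((T ^^ n) x) ((T ^^ n) y) < e"
proof -
  have "\<exists>d>0. \<forall>x\<in>X. \<forall>y\<in>X. dist x y < d \<longrightarrow> dist ((T ^^ n) x) ((T ^^ n) y) < e" for n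
    using compact_uniformly_continuous[OF continuous_on_funpow[OF assms(2,3)] assms(1)] \<open>e > 0\<close>
    unfolding uniformly_continuous_on_def by (metis dist_commute)
  then obtain d where d: "\<And>n. d n > 0"
    "\<And>n x y. x \<in> X \<Longrightarrow> y \<in> X \<Longrightarrow> dist x y < d n \<Longrightarrow> dist ((T ^^ n) x) ((T ^^ n) y) < e"
    by metis
  show thesis
  proof
    show "Min (d ` {..N}) > 0" using d(1) by simp
    show "dist ((T ^^ n) x) ((T ^^ n) y) < e"
      if "x \<in> X" "y \<in> X" "n \<le> N" "dist x y < Min (d ` {..N})" for x y n
      using that by (intro d(2)) auto
  qed
qed

text \<open>Continuity of the iterates turns one close time into arbitrarily late ones, so the lower limit
  is an infimum.\<close>

lemma proximal_pair_iff:
  fixes T :: "'a::metric_space \<Rightarrow> 'a"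
  assumes "compact X" "continuous_on X T" "T ` X \<subseteq> X" "x \<in> X" "y \<in> X"
  shows "proximal_pair T x y \<longleftrightarrow> (\<forall>e>0. \<exists>k. dist ((T ^^ k) x) ((T ^^ k) y) < e)"
    (is "_ \<longleftrightarrow> ?R")
proof
  assume P: "proximal_pair T x y"
  show ?R
  proof (intro allI impI, rule ccontr)
    fix e :: real
    assume "e > 0" and "\<nexists>k. dist ((T ^^ k) x) ((T ^^ k) y) < e"
    then have "ereal e \<le> liminf (\<lambda>k. ereal (dist ((T ^^ k) x) ((T ^^ k) y)))"
      by (intro Liminf_bounded) (auto simp: not_less)
    then show False using P \<open>e > 0\<close> by (simp add: proximal_pair_def)
  qed
next
  assume R: ?R
  let ?f = "\<lambda>k. ereal (dist ((T ^^ k) x) ((T ^^ k) y))"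
  have "liminf ?f \<le> 0"
  proof (rule ccontr)
    assume "\<not> liminf ?f \<le> 0"
    then obtain e where e: "0 < ereal e" "ereal e < liminf ?f"
      using ereal_dense2 [of 0 "liminf ?f"] by (auto simp: not_le)
    then obtain N where N: "\<And>k. k \<ge> N \<Longrightarrow> e < dist ((T ^^ k) x) ((T ^^ k) y)"
      using less_LiminfD[OF e(2)] by (auto simp: eventually_sequentially)
    obtain d where "d > 0" and d: "\<And>a b n. a \<in> X \<Longrightarrow> b \<in> X \<Longrightarrow> n \<le> N \<Longrightarrow> dist a b < d
        \<Longrightarrow> dist ((T ^^ n) a) ((T ^^ n) b) < e"
      using equicontinuous_funpow_upto[OF assms(1-3), of e N] e(1) by auto
    obtain k where "dist ((T ^^ k) x) ((T ^^ k) y) < d" using R \<open>d > 0\<close> by blast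
    then have "dist ((T ^^ N) ((T ^^ k) x)) ((T ^^ N) ((T ^^ k) y)) < e"
      using d assms by (simp add: funpow_in)
    then show False using N[of "N + k"] by (simp add: funpow_add)
  qed
  moreover have "0 \<le> liminf ?f" by (intro Liminf_bounded) simp
  ultimately show "proximal_pair T x y" unfolding proximal_pair_def by simp
qed

section \<open>Idempotent limits along an IP-set\<close>

text \<open>The idempotent is a limit of \<open>T ^^ (\<Sum>i\<in>\<alpha>. p i)\<close> as \<open>\<alpha>\<close> moves off to infinity. To stay within
  plain composition on the full function space, every map is extended by the identity off \<open>X\<close>.\<close>

lemma IP_limit_idempotent:
  fixes T :: "'a::metric_space \<Rightarrow> 'a" and p :: "nat \<Rightarrow> nat"
  assumes X: "compact X" and T: "continuous_on X T" "T ` X \<subseteq> X"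
  obtains u where "\<And>x. x \<in> X \<Longrightarrow> u x \<in> X" "\<And>x. x \<in> X \<Longrightarrow> u (u x) = u x"
    "\<And>F e. finite F \<Longrightarrow> F \<subseteq> X \<Longrightarrow> e > 0 \<Longrightarrow>
       \<exists>\<alpha>. finite \<alpha> \<and> \<alpha> \<noteq> {} \<and> \<alpha> \<subseteq> {1..} \<and> (\<forall>x\<in>F. dist ((T ^^ (\<Sum>i\<in>\<alpha>. p i)) x) (u x) < e)"
proof -
  \<comment> \<open>Singleton factors off \<open>X\<close> make the product compact by Tychonoff,
    although the whole type need not be compact.\<close>
  define K where "K = (PiE UNIV (\<lambda>x. if x \<in> X then X else {x}))"
  define s where "s = (\<lambda>n x. if x \<in> X then (T ^^ n) x else x)"
  define A where "A = (\<lambda>n. {s (\<Sum>i\<in>\<alpha>. p i) | \<alpha>. finite \<alpha> \<and> \<alpha> \<noteq> {} \<and> \<alpha> \<subseteq> {n..}})"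
  \<comment> \<open>The cluster points of the finite sums as the index sets move off to
    infinity.\<close>
  define S where "S = (\<Inter>n\<in>{1..}. closure (A n))"
  have K_in: "g x \<in> X" if "g \<in> K" "x \<in> X" for g x
    using PiE_mem[OF that(1)[unfolded K_def] UNIV_I, of x] that(2) by simp
  have K_off: "g x = x" if "g \<in> K" "x \<notin> X" for g x
    using PiE_mem[OF that(1)[unfolded K_def] UNIV_I, of x] that(2) by simp
  have "compactin (product_topology (\<lambda>_. euclidean) UNIV) K"
    using X unfolding K_def by (subst compactin_PiE) auto
  then have K: "compact K" by (simp add: euclidean_product_topology)
  then have "closed K" by (rule compact_imp_closed)
  have sK: "s n \<in> K" for n
    using funpow_in[OF T(2)] by (auto simp: K_def s_def PiE_def)
  then have "A n \<subseteq> K" for n by (auto simp: A_def)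
  then have AK: "closure (A n) \<subseteq> K" for n using \<open>closed K\<close> by (rule closure_minimal)
  have s_add: "s m \<circ> s n = s (m + n)" for m n
    using funpow_in[OF T(2)] by (auto simp: s_def funpow_add)
  have antimono: "A n \<subseteq> A m" if "m \<le> n" for m n
    using that unfolding A_def by fastforce
  have "A n \<noteq> {}" for n unfolding A_def by (force intro: exI[of _ "{n}"])
  \<comment> \<open>The sets \<open>A n\<close> are non-empty and decreasing, so the one with the
    largest index lies in every finite intersection; the inserted 0 covers the empty family.\<close>
  have "K \<inter> S \<noteq> {}" unfolding S_def
  proof (rule compact_imp_fip_image[OF K])
    fix I' :: "nat set" assume I': "finite I'"
    then have "A (Max (insert 0 I')) \<subseteq> closure (A n)" if "n \<in> I'" for n
      using that antimono[of n "Max (insert 0 I')"] closure_subset[of "A n"] by auto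
    then have "A (Max (insert 0 I')) \<subseteq> K \<inter> (\<Inter>n\<in>I'. closure (A n))"
      using \<open>\<And>n. A n \<subseteq> K\<close> by blast
    then show "K \<inter> (\<Inter>n\<in>I'. closure (A n)) \<noteq> {}" using \<open>\<And>n. A n \<noteq> {}\<close> by blast
  qed simp
  then have "S \<noteq> {}" by blast
  have "S \<subseteq> K" using AK[of 1] unfolding S_def by auto
  have "compact S"
    using compact_Int_closed[OF K, of S] \<open>S \<subseteq> K\<close> by (auto simp: S_def Int_absorb1)
  \<comment> \<open>Composition is always continuous in its left factor, but in its right factor in
    general only behind a continuous map. So \<open>comp\<close> passes to the limit in two stages:
    first in the right factor, behind a fixed \<open>s n\<close>, then in the left.\<close>
  have right: "continuous_on UNIV (\<lambda>f::'a \<Rightarrow> 'a. f \<circ> g)" for g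
    by (intro continuous_on_coordinatewise_then_product) (simp add: o_def)
  \<comment> \<open>\<open>s n\<close> need not be continuous on the whole type, but at each
    coordinate the members of \<open>K\<close> either take values in \<open>X\<close>, where the
    iterate is continuous, or are constant.\<close>
  have left: "continuous_on K (\<lambda>g. s n \<circ> g)" for n
  proof (intro continuous_on_coordinatewise_then_product)
    fix x
    show "continuous_on K (\<lambda>g. (s n \<circ> g) x)"
    proof (cases "x \<in> X")
      case True
      have "continuous_on K (\<lambda>g. (T ^^ n) (g x))"
      proof (rule continuous_on_compose2[OF continuous_on_funpow[OF T]])
        show "continuous_on K (\<lambda>g. g x)"
          by (rule continuous_on_subset[OF continuous_on_product_coordinates subset_UNIV])
        show "(\<lambda>g. g x) ` K \<subseteq> X" using True K_in by auto
      qed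
      moreover have "(s n \<circ> g) x = (T ^^ n) (g x)" if "g \<in> K" for g
        using K_in[OF that True] by (simp add: s_def)
      ultimately show ?thesis by (simp cong: continuous_on_cong)
    next
      case False
      then have "(s n \<circ> g) x = x" if "g \<in> K" for g
        using K_off[OF that False] False by (simp add: s_def)
      then show ?thesis by (simp cong: continuous_on_cong)
    qed
  qed
  have comp: "f \<circ> g \<in> S" if fg: "f \<in> S" "g \<in> S" for f g
    unfolding S_def
  proof
    fix n :: nat assume "n \<in> {1..}"
    have "h \<circ> g \<in> closure (A n)" if h: "h \<in> A n" for h
    proof -
      obtain \<alpha> where \<alpha>: "h = s (\<Sum>i\<in>\<alpha>. p i)" "finite \<alpha>" "\<alpha> \<noteq> {}" "\<alpha> \<subseteq> {n..}"
        using h by (auto simp: A_def)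
      \<comment> \<open>Index sets starting at \<open>?m\<close> lie beyond \<alpha>, so they are
        disjoint from it and composition becomes the sum over the union.\<close>
      let ?m = "Suc (Max \<alpha>)"
      have "(\<lambda>g. h \<circ> g) ` A ?m \<subseteq> A n"
      proof clarify
        fix k assume "k \<in> A ?m"
        then obtain \<beta> where \<beta>: "k = s (\<Sum>i\<in>\<beta>. p i)" "finite \<beta>" "\<beta> \<noteq> {}" "\<beta> \<subseteq> {?m..}"
          by (auto simp: A_def)
        have "\<alpha> \<inter> \<beta> = {}" using \<alpha>(2) \<beta>(4) Max_ge[OF \<alpha>(2)] by fastforce
        then have "h \<circ> k = s (\<Sum>i\<in>\<alpha> \<union> \<beta>. p i)"
          using \<alpha> \<beta> by (simp add: s_add sum.union_disjoint)
        moreover have "\<beta> \<subseteq> {n..}"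
          using \<beta>(4) \<alpha> Max_in[OF \<alpha>(2,3)] by fastforce
        ultimately show "h \<circ> k \<in> A n"
          unfolding A_def using \<alpha> \<beta> by (auto intro!: exI[of _ "\<alpha> \<union> \<beta>"])
      qed
      then have "(\<lambda>g. h \<circ> g) ` closure (A ?m) \<subseteq> closure (A n)"
        using closure_subset[of "A n"] \<alpha>(1)
        by (intro image_closure_subset) (auto intro: continuous_on_subset[OF left AK])
      moreover have "g \<in> closure (A ?m)" using fg(2) unfolding S_def by auto
      ultimately show ?thesis by blast
    qed
    then have "(\<lambda>f. f \<circ> g) ` closure (A n) \<subseteq> closure (A n)"
      by (intro image_closure_subset) (auto intro: continuous_on_subset[OF right])
    moreover have "f \<in> closure (A n)" using fg(1) \<open>n \<in> {1..}\<close> unfolding S_def by auto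
    ultimately show "f \<circ> g \<in> closure (A n)" by blast
  qed
  obtain u where u: "u \<in> S" "u \<circ> u = u"
  proof (rule ellis_numakura[OF \<open>compact S\<close> \<open>S \<noteq> {}\<close>, of "(\<circ>)"])
    show "continuous_on S (\<lambda>f. f \<circ> g)" for g
      by (rule continuous_on_subset[OF right subset_UNIV])
  qed (simp_all add: comp comp_assoc)
  show thesis
  proof
    show "u x \<in> X" if "x \<in> X" for x
      using that u(1) \<open>S \<subseteq> K\<close> K_in by auto
    show "u (u x) = u x" for x using u(2) by (metis comp_apply)
  next
    fix F :: "'a set" and e :: real
    assume F: "finite F" "F \<subseteq> X" "e > 0"
    \<comment> \<open>A basic neighbourhood of \<open>u\<close> for pointwise convergence: it
      constrains all points of \<open>F\<close> at once, so one \<alpha> serves them all.\<close>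
    let ?O = "\<Inter>x\<in>F. (\<lambda>f. f x) -` ball (u x) e"
    have "open ?O"
      using F(1) by (intro open_INT ballI open_vimage continuous_on_product_coordinates) auto
    moreover have "u \<in> ?O" using \<open>e > 0\<close> by auto
    moreover have "u \<in> closure (A 1)" using u(1) by (auto simp: S_def)
    ultimately obtain f where "f \<in> A 1" "f \<in> ?O"
      using open_Int_closure_eq_empty[of ?O "A 1"] by blast
    then obtain \<alpha> where \<alpha>: "finite \<alpha>" "\<alpha> \<noteq> {}" "\<alpha> \<subseteq> {1..}" and "s (\<Sum>i\<in>\<alpha>. p i) \<in> ?O"
      by (auto simp: A_def)
    then have "dist ((T ^^ (\<Sum>i\<in>\<alpha>. p i)) x) (u x) < e" if "x \<in> F" for x
      using that F(2) by (auto simp: s_def dist_commute subset_iff)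
    with \<alpha> show "\<exists>\<alpha>. finite \<alpha> \<and> \<alpha> \<noteq> {} \<and> \<alpha> \<subseteq> {1..} \<and>
        (\<forall>x\<in>F. dist ((T ^^ (\<Sum>i\<in>\<alpha>. p i)) x) (u x) < e)"
      by (intro exI[of _ \<alpha>]) simp
  qed
qed

section \<open>From distality to equicontinuity\<close>

lemma distal_IP_recurrent:
  fixes T :: "'a::metric_space \<Rightarrow> 'a" and p :: "nat \<Rightarrow> nat"
  assumes X: "compact X" and T: "continuous_on X T" "T ` X \<subseteq> X" and "distal_system X T"
    and F: "finite F" "F \<subseteq> X" "e > 0"
  shows "\<exists>\<alpha>. finite \<alpha> \<and> \<alpha> \<noteq> {} \<and> \<alpha> \<subseteq> {1..} \<and>
    (\<forall>x\<in>F. dist ((T ^^ (\<Sum>i\<in>\<alpha>. p i)) x) x < e)"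
proof (rule IP_limit_idempotent[OF X T, of p])
  fix u
  assume u: "\<And>x. x \<in> X \<Longrightarrow> u x \<in> X" "\<And>x. x \<in> X \<Longrightarrow> u (u x) = u x"
    and lim: "\<And>F e. finite F \<Longrightarrow> F \<subseteq> X \<Longrightarrow> e > 0 \<Longrightarrow>
       \<exists>\<alpha>. finite \<alpha> \<and> \<alpha> \<noteq> {} \<and> \<alpha> \<subseteq> {1..} \<and> (\<forall>x\<in>F. dist ((T ^^ (\<Sum>i\<in>\<alpha>. p i)) x) (u x) < e)"
  have "u x = x" if x: "x \<in> X" for x
  proof -
    have "\<exists>k. dist ((T ^^ k) x) ((T ^^ k) (u x)) < e" if "e > 0" for e
    proof -
      \<comment> \<open>Since \<open>u (u x) = u x\<close>, one common sum carries both
        \<open>x\<close> and \<open>u x\<close> close to the same point \<open>u x\<close>.\<close>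
      obtain \<alpha> where "\<forall>y\<in>{x, u x}. dist ((T ^^ (\<Sum>i\<in>\<alpha>. p i)) y) (u y) < e / 2"
        using lim[of "{x, u x}" "e / 2"] x u(1) \<open>e > 0\<close> by auto
      then have "dist ((T ^^ (\<Sum>i\<in>\<alpha>. p i)) x) (u x) < e / 2"
        "dist ((T ^^ (\<Sum>i\<in>\<alpha>. p i)) (u x)) (u x) < e / 2"
        using u(2)[OF x] by auto
      then show ?thesis
        by (blast intro: dist_triangle_half_l)
    qed
    then have "proximal_pair T x (u x)"
      by (simp add: proximal_pair_iff[OF X T x u(1)[OF x]])
    then show ?thesis
      using \<open>distal_system X T\<close> x u(1)[OF x] unfolding distal_system_def distal_pair_def by metis
  qed
  then have "\<forall>x\<in>F. u x = x" using F(2) by blast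
  with lim[OF F] show ?thesis by simp
qed

lemma IP_star_setI:
  assumes "F \<subseteq> {1..}"
    and meets: "\<And>p :: nat \<Rightarrow> nat.
      \<forall>i\<ge>1. p i \<ge> 1 \<Longrightarrow> \<exists>\<alpha>. finite \<alpha> \<and> \<alpha> \<noteq> {} \<and> \<alpha> \<subseteq> {1..} \<and> (\<Sum>i\<in>\<alpha>. p i) \<in> F"
  shows "IP_star_set F"
  unfolding IP_star_set_def
proof (intro conjI allI impI assms(1))
  fix A assume "IP_set A"
  then have "\<exists>p :: nat \<Rightarrow> nat. (\<forall>i\<ge>1. p i \<ge> 1) \<and>
      (\<forall>\<alpha>. finite \<alpha> \<and> \<alpha> \<noteq> {} \<and> \<alpha> \<subseteq> {1..} \<longrightarrow> (\<Sum>i\<in>\<alpha>. p i) \<in> A)"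
    unfolding IP_set_def by (rule conjunct2)
  then obtain p :: "nat \<Rightarrow> nat" where p1: "\<forall>i\<ge>1. p i \<ge> 1"
    and p: "\<forall>\<alpha>. finite \<alpha> \<and> \<alpha> \<noteq> {} \<and> \<alpha> \<subseteq> {1..} \<longrightarrow> (\<Sum>i\<in>\<alpha>. p i) \<in> A"
    by (elim exE conjE) (rule that)
  show "F \<inter> A \<noteq> {}" using meets[OF p1] p by blast
qed

lemma distal_imp_pairwise_IP_star_equicontinuous:
  fixes T :: "'a::metric_space \<Rightarrow> 'a"
  assumes X: "compact X" and T: "continuous_on X T" "T ` X \<subseteq> X" and D: "distal_system X T"
  shows "pairwise_IP_star_equicontinuous X T"
  unfolding pairwise_IP_star_equicontinuous_def pairwise_IP_star_equicontinuous_at_def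
proof (intro ballI allI impI)
  fix x and e :: real
  assume x: "x \<in> X" and e: "e > 0"
  \<comment> \<open>The path from \<open>(T ^^ k) y\<close> through \<open>y\<close>,
    \<open>x\<close> and \<open>z\<close> to \<open>(T ^^ k) z\<close> has four legs, each shorter
    than \<open>e / 4\<close>.\<close>
  let ?U = "X \<inter> ball x (e / 4)"
  have "IP_star_set {k. 1 \<le> k \<and> dist ((T ^^ k) y) ((T ^^ k) z) < e}"
    if yz: "y \<in> ?U" "z \<in> ?U" for y z
  proof (rule IP_star_setI)
    fix p :: "nat \<Rightarrow> nat"
    assume p: "\<forall>i\<ge>1. 1 \<le> p i"
    obtain \<alpha> where \<alpha>: "finite \<alpha>" "\<alpha> \<noteq> {}" "\<alpha> \<subseteq> {1..}"
      and ret: "\<forall>w\<in>{y, z}. dist ((T ^^ (\<Sum>i\<in>\<alpha>. p i)) w) w < e / 4"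
      using distal_IP_recurrent[OF X T D, of "{y, z}" "e / 4" p] yz e by auto
    let ?k = "\<Sum>i\<in>\<alpha>. p i"
    have "dist ((T ^^ ?k) y) y < e / 4" "dist ((T ^^ ?k) z) z < e / 4"
      using ret by auto
    moreover have "dist x y < e / 4" "dist x z < e / 4" using yz by auto
    ultimately have close: "dist ((T ^^ ?k) y) ((T ^^ ?k) z) < e"
      using dist_triangle[of "(T ^^ ?k) y" "(T ^^ ?k) z" y]
        dist_triangle[of y "(T ^^ ?k) z" z] dist_triangle[of y z x]
      by (simp add: dist_commute)
    have "1 \<le> ?k"
    proof -
      obtain i where "i \<in> \<alpha>" using \<alpha>(2) by blast
      then have "1 \<le> p i" "p i \<le> ?k" using p \<alpha> member_le_sum[of i \<alpha> p] by auto
      then show ?thesis by linarith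
    qed
    then show "\<exists>\<alpha>. finite \<alpha> \<and> \<alpha> \<noteq> {} \<and> \<alpha> \<subseteq> {1..} \<and>
        (\<Sum>i\<in>\<alpha>. p i) \<in> {k. 1 \<le> k \<and> dist ((T ^^ k) y) ((T ^^ k) z) < e}"
      using \<alpha> close by (intro exI[of _ \<alpha>]) simp
  qed auto
  then show "\<exists>U. openin (top_of_set X) U \<and> x \<in> U \<and>
      (\<forall>y\<in>U. \<forall>z\<in>U. IP_star_set {k. 1 \<le> k \<and> dist ((T ^^ k) y) ((T ^^ k) z) < e})"
    using x e by (intro exI[of _ ?U]) auto
qed


section \<open>Return times in minimal systems\<close>

text \<open>This is syndeticity. Every orbit closure is a subsystem, hence all of \<open>X\<close>,
  so every orbit meets the ball. The points that do so at time \<open>j\<close> form a relatively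
  open set, and a finite subcover bounds the waiting time.\<close>

lemma minimal_visits_ball:
  fixes T :: "'a::metric_space \<Rightarrow> 'a"
  assumes min: "minimal_system X T" and x: "x \<in> X" and "r > 0"
  obtains N where "\<And>z. z \<in> X \<Longrightarrow> \<exists>j\<le>N. dist x ((T ^^ j) z) < r"
proof -
  have X: "compact X" and T: "continuous_on X T" "T ` X \<subseteq> X"
    using min by (auto simp: minimal_system_def dynamical_system_def)
  have visit: "\<exists>j. dist x ((T ^^ j) z) < r" if z: "z \<in> X" for z
  proof -
    let ?O = "range (\<lambda>j. (T ^^ j) z)" and ?Y = "closure (range (\<lambda>j. (T ^^ j) z))"
    have sub: "?Y \<subseteq> X"
      using funpow_in[OF T(2) z] compact_imp_closed[OF X] by (intro closure_minimal) auto
    have "T ` ?Y \<subseteq> ?Y"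
    proof (rule image_closure_subset)
      have "T ((T ^^ j) z) \<in> ?O" for j using rangeI[of "\<lambda>j. (T ^^ j) z" "Suc j"] by simp
      then show "T ` ?O \<subseteq> ?Y" using closure_subset[of ?O] by blast
    qed (use sub T(1) continuous_on_subset in auto)
    then have "subsystem X T ?Y"
      using sub by (auto simp: subsystem_def closed_subset)
    then have "?Y = X" using min sub unfolding minimal_system_def by blast
    then show ?thesis
      using x \<open>r > 0\<close> closure_approachable[of x ?O] by (auto simp: dist_commute)
  qed
  have "\<exists>V. open V \<and> V \<inter> X = (T ^^ j) -` ball x r \<inter> X" for j
    using continuous_on_open_invariant continuous_on_funpow[OF T] open_ball by metis
  then obtain V where V: "\<And>j. open (V j)" "\<And>j. V j \<inter> X = (T ^^ j) -` ball x r \<inter> X"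
    by metis
  have "X \<subseteq> (\<Union>j. V j)"
  proof
    fix z assume z: "z \<in> X"
    then obtain j where "z \<in> (T ^^ j) -` ball x r \<inter> X" using visit by auto
    then show "z \<in> (\<Union>j. V j)" using V(2) by blast
  qed
  then obtain J where J: "finite J" "X \<subseteq> (\<Union>j\<in>J. V j)"
    using compactE_image[OF X, of UNIV V] V(1) by auto
  show thesis
  proof
    fix z assume "z \<in> X"
    then obtain j where "j \<in> J" "z \<in> V j \<inter> X" using J(2) by auto
    then have "dist x ((T ^^ j) z) < r" "j \<le> Max J" using V(2) J(1) by auto
    then show "\<exists>j\<le>Max J. dist x ((T ^^ j) z) < r" by blast
  qed
qed

text \<open>At a time when the orbits are very close, wait until that of \<open>x\<close> comes back
  near \<open>x\<close>. The wait is bounded, so the orbit of \<open>y\<close> is still close to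
  it.\<close>

lemma proximal_simultaneous_return:
  fixes T :: "'a::metric_space \<Rightarrow> 'a"
  assumes min: "minimal_system X T" and xy: "x \<in> X" "y \<in> X" and prox: "proximal_pair T x y"
    and "r > 0"
  obtains k where "k \<ge> 1" "dist x ((T ^^ k) x) < r" "dist x ((T ^^ k) y) < r"
proof -
  have X: "compact X" and T: "continuous_on X T" "T ` X \<subseteq> X"
    using min by (auto simp: minimal_system_def dynamical_system_def)
  obtain N where N: "\<And>z. z \<in> X \<Longrightarrow> \<exists>j\<le>N. dist x ((T ^^ j) z) < r / 2"
    using minimal_visits_ball[OF min xy(1), of "r / 2"] \<open>r > 0\<close> by auto
  \<comment> \<open>The wait is counted from \<open>Suc m\<close>, which makes the return time
    positive, while closeness is known at \<open>m\<close>; hence \<open>Suc N\<close>.\<close>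
  obtain d where "d > 0" and d: "\<And>a b n. a \<in> X \<Longrightarrow> b \<in> X \<Longrightarrow> n \<le> Suc N \<Longrightarrow> dist a b < d
      \<Longrightarrow> dist ((T ^^ n) a) ((T ^^ n) b) < r / 2"
    using equicontinuous_funpow_upto[OF X T, of "r / 2" "Suc N"] \<open>r > 0\<close> by auto
  obtain m where m: "dist ((T ^^ m) x) ((T ^^ m) y) < d"
    using prox \<open>d > 0\<close> proximal_pair_iff[OF X T xy] by blast
  obtain j where j: "j \<le> N" "dist x ((T ^^ j) ((T ^^ Suc m) x)) < r / 2"
    using N funpow_in[OF T(2) xy(1)] by blast
  have shift: "(T ^^ (Suc j + m)) z = (T ^^ j) ((T ^^ Suc m) z)" for z
    by (simp add: funpow_add funpow_swap1)
  have "dist ((T ^^ (Suc j + m)) x) ((T ^^ (Suc j + m)) y) < r / 2"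
    using d[of "(T ^^ m) x" "(T ^^ m) y" "Suc j"] m j(1) funpow_in[OF T(2)] xy
    by (simp add: funpow_add)
  moreover have "dist x ((T ^^ (Suc j + m)) x) < r / 2" using j(2) by (simp only: shift)
  ultimately show thesis
    using that[of "Suc j + m"] \<open>r > 0\<close>
      dist_triangle[of x "(T ^^ (Suc j + m)) y" "(T ^^ (Suc j + m)) x"]
    by linarith
qed

text \<open>Generators are chosen one by one: the next one must translate all earlier finite sums
  into \<open>G\<close>. The empty sum 0 is kept among them, so that the generator itself lands in
  \<open>G\<close>.\<close>

lemma IP_set_if_finite_translates:
  assumes G: "G \<subseteq> {1..}"
    and ext: "\<And>F. finite F \<Longrightarrow> F \<subseteq> insert 0 G \<Longrightarrow> \<exists>p\<ge>1. \<forall>k\<in>F. k + p \<in> G"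
  shows "IP_set G"
proof -
  \<comment> \<open>A state pairs a finite set containing all sums so far with the latest generator;
    the generator of the initial state is a dummy.\<close>
  define P where "P = (\<lambda>(n::nat) (F, p::nat). finite F \<and> 0 \<in> F \<and> F \<subseteq> insert 0 G)"
  define Q where "Q = (\<lambda>(n::nat) (F, p::nat) (F', p').
    p' \<ge> 1 \<and> (\<forall>k\<in>F. k + p' \<in> G) \<and> F' = F \<union> (\<lambda>k. k + p') ` F)"
  have "\<exists>f. \<forall>n. P n (f n) \<and> Q n (f n) (f (Suc n))"
  proof (rule dependent_nat_choice)
    show "\<exists>z. P 0 z" by (rule exI[of _ "({0}, 1)"]) (simp add: P_def)
    fix z :: "nat set \<times> nat" and n assume z: "P n z"
    obtain F p where F: "z = (F, p)" by force
    with z obtain q where q: "q \<ge> 1" "\<forall>k\<in>F. k + q \<in> G" using ext[of F] by (auto simp: P_def)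
    then show "\<exists>z'. P (Suc n) z' \<and> Q n z z'"
      using z F by (intro exI[of _ "(F \<union> (\<lambda>k. k + q) ` F, q)"]) (auto simp: P_def Q_def)
  qed
  then obtain f where f: "\<And>n. P n (f n)" "\<And>n. Q n (f n) (f (Suc n))" by auto
  define F p where "F = fst \<circ> f" and "p = snd \<circ> f"
  have F0: "0 \<in> F n" for n using f(1)[of n] by (auto simp: P_def F_def split: prod.splits)
  have step: "p (Suc n) \<ge> 1" "\<And>k. k \<in> F n \<Longrightarrow> k + p (Suc n) \<in> G"
    "F (Suc n) = F n \<union> (\<lambda>k. k + p (Suc n)) ` F n" for n
    using f(2)[of n] by (auto simp: Q_def F_def p_def split: prod.splits)
  \<comment> \<open>If \<open>Suc n\<close> is in \<alpha>, the remaining indices sum to a member of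
    \<open>F n\<close>, which adding \<open>p (Suc n)\<close> moves into \<open>G\<close>.\<close>
  have sums: "(\<Sum>i\<in>\<alpha>. p i) \<in> F n \<and> (\<alpha> \<noteq> {} \<longrightarrow> (\<Sum>i\<in>\<alpha>. p i) \<in> G)" if "\<alpha> \<subseteq> {1..n}" for \<alpha> n
    using that
  proof (induction n arbitrary: \<alpha>)
    case (Suc n)
    show ?case
    proof (cases "Suc n \<in> \<alpha>")
      case True
      let ?\<beta> = "\<alpha> - {Suc n}"
      have "?\<beta> \<subseteq> {1..n}" using Suc.prems by (auto simp: le_Suc_eq)
      then have "(\<Sum>i\<in>?\<beta>. p i) \<in> F n" using Suc.IH by blast
      moreover have "(\<Sum>i\<in>\<alpha>. p i) = (\<Sum>i\<in>?\<beta>. p i) + p (Suc n)"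
        using True finite_subset[OF Suc.prems] by (simp add: sum.remove[of \<alpha> "Suc n"])
      ultimately show ?thesis using step by auto
    next
      case False
      then have "\<alpha> \<subseteq> {1..n}" using Suc.prems by (auto simp: le_Suc_eq)
      then show ?thesis using Suc.IH step(3) by auto
    qed
  qed (simp add: F0)
  show ?thesis
    unfolding IP_set_def
  proof (intro conjI exI[of _ p] allI impI)
    show "1 \<le> p i" if "1 \<le> i" for i using step(1)[of "i - 1"] that by simp
    fix \<alpha> :: "nat set" assume \<alpha>: "finite \<alpha> \<and> \<alpha> \<noteq> {} \<and> \<alpha> \<subseteq> {1..}"
    then have "\<alpha> \<subseteq> {1..Max \<alpha>}" by auto
    then show "(\<Sum>i\<in>\<alpha>. p i) \<in> G" using sums \<alpha> by blast
  qed (rule G)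
qed

text \<open>Finitely many return times of \<open>x\<close> leave a common slack \<open>e\<close>
  below \<open>r\<close>. If \<open>p\<close> brings both points close enough to \<open>x\<close>,
  then \<open>k\<close> further steps bring both within \<open>e\<close> of
  \<open>(T ^^ k) x\<close>, hence within \<open>r\<close> of \<open>x\<close>.\<close>

lemma proximal_return_times_IP:
  fixes T :: "'a::metric_space \<Rightarrow> 'a"
  assumes min: "minimal_system X T" and xy: "x \<in> X" "y \<in> X" and prox: "proximal_pair T x y"
    and "r > 0"
  shows "IP_set {k. k \<ge> 1 \<and> dist x ((T ^^ k) x) < r \<and> dist x ((T ^^ k) y) < r}" (is "IP_set ?G")
proof (rule IP_set_if_finite_translates)
  have X: "compact X" and T: "continuous_on X T" "T ` X \<subseteq> X"
    using min by (auto simp: minimal_system_def dynamical_system_def)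
  fix F assume F: "finite F" "F \<subseteq> insert 0 ?G"
  \<comment> \<open>Inserting 0 keeps the set non-empty for \<open>Min\<close>.\<close>
  define e where "e = Min ((\<lambda>k. r - dist x ((T ^^ k) x)) ` insert 0 F)"
  have "e > 0" unfolding e_def using F \<open>r > 0\<close> by (subst Min_gr_iff) auto
  have e: "dist x ((T ^^ k) x) + e \<le> r" if "k \<in> F" for k
  proof -
    have "e \<le> r - dist x ((T ^^ k) x)" unfolding e_def using F(1) that by (intro Min_le) auto
    then show ?thesis by simp
  qed
  obtain d where "d > 0" and d: "\<And>a b n. a \<in> X \<Longrightarrow> b \<in> X \<Longrightarrow> n \<le> Max (insert 0 F)
      \<Longrightarrow> dist a b < d \<Longrightarrow> dist ((T ^^ n) a) ((T ^^ n) b) < e"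
    using equicontinuous_funpow_upto[OF X T \<open>e > 0\<close>, of "Max (insert 0 F)"] by auto
  obtain p where p: "p \<ge> 1" "dist x ((T ^^ p) x) < d" "dist x ((T ^^ p) y) < d"
    using proximal_simultaneous_return[OF min xy prox \<open>d > 0\<close>] by auto
  have "dist x ((T ^^ (k + p)) z) < r" if "k \<in> F" "z \<in> X" "dist x ((T ^^ p) z) < d" for k z
  proof -
    have "dist ((T ^^ k) x) ((T ^^ k) ((T ^^ p) z)) < e"
      using that F(1) xy(1) funpow_in[OF T(2)] by (intro d) auto
    then show ?thesis
      using e[OF that(1)] dist_triangle[of x "(T ^^ (k + p)) z" "(T ^^ k) x"]
      by (simp add: funpow_add)
  qed
  then show "\<exists>p\<ge>1. \<forall>k\<in>F. k + p \<in> ?G" using p xy by (intro exI[of _ p]) auto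
qed auto

section \<open>From equicontinuity to distality\<close>

lemma pairwise_IP_star_equicontinuous_imp_distal:
  fixes T :: "'a::metric_space \<Rightarrow> 'a"
  assumes min: "minimal_system X T" and eq: "pairwise_IP_star_equicontinuous X T"
  shows "distal_system X T"
  unfolding distal_system_def distal_pair_def
proof (intro ballI impI notI)
  fix x y assume xy: "x \<in> X" "y \<in> X" "x \<noteq> y" and prox: "proximal_pair T x y"
  have X: "compact X" and T: "continuous_on X T" "T ` X \<subseteq> X"
    using min by (auto simp: minimal_system_def dynamical_system_def)
  \<comment> \<open>The closing path from \<open>x\<close> through \<open>(T ^^ n) y\<close>,
    \<open>(T ^^ n) ((T ^^ k) x)\<close> and \<open>(T ^^ k) x\<close> to \<open>y\<close> is
    shorter than \<open>e / 2 + e + e / 2 + e\<close>, that is, \<open>3 * e\<close>.\<close>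
  define e where "e = dist x y / 3"
  have "e > 0" using xy(3) by (simp add: e_def)
  have "pairwise_IP_star_equicontinuous_at X T y"
    using eq xy(2) by (simp add: pairwise_IP_star_equicontinuous_def)
  then obtain U where U: "openin (top_of_set X) U" "y \<in> U"
    and star: "\<forall>a\<in>U. \<forall>b\<in>U. IP_star_set {k. k \<ge> 1 \<and> dist ((T ^^ k) a) ((T ^^ k) b) < e}"
    using \<open>e > 0\<close> unfolding pairwise_IP_star_equicontinuous_at_def by blast
  obtain s where s: "s > 0" "ball y s \<inter> X \<subseteq> U"
    using U by (meson openin_contains_ball)
  \<comment> \<open>The bound \<open>s\<close> puts the orbit point into \<open>U\<close>; the bound
    \<open>e\<close> is the last leg of the closing path.\<close>
  obtain k where k: "dist y ((T ^^ k) x) < min s e"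
    using minimal_visits_ball[OF min xy(2), of "min s e"] xy(1) s(1) \<open>e > 0\<close>
    by (metis min_less_iff_conj)
  have "(T ^^ k) x \<in> U" using s(2) k funpow_in[OF T(2) xy(1)] by auto
  obtain d where "d > 0" and d: "\<And>a b n. a \<in> X \<Longrightarrow> b \<in> X \<Longrightarrow> n \<le> k \<Longrightarrow> dist a b < d
      \<Longrightarrow> dist ((T ^^ n) a) ((T ^^ n) b) < e / 2"
    using equicontinuous_funpow_upto[OF X T, of "e / 2" k] \<open>e > 0\<close> by auto
  \<comment> \<open>\<open>d\<close> keeps \<open>(T ^^ k) ((T ^^ n) x)\<close> near
    \<open>(T ^^ k) x\<close>; \<open>e / 2\<close> bounds the leg from \<open>x\<close> to
    \<open>(T ^^ n) y\<close>.\<close>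
  let ?r = "min d (e / 2)"
  have "IP_set {n. n \<ge> 1 \<and> dist x ((T ^^ n) x) < ?r \<and> dist x ((T ^^ n) y) < ?r}"
    using \<open>d > 0\<close> \<open>e > 0\<close> by (intro proximal_return_times_IP[OF min xy(1,2) prox]) auto
  moreover have "IP_star_set {n. n \<ge> 1 \<and> dist ((T ^^ n) y) ((T ^^ n) ((T ^^ k) x)) < e}"
    using star U(2) \<open>(T ^^ k) x \<in> U\<close> by blast
  ultimately obtain n where n: "dist x ((T ^^ n) x) < ?r" "dist x ((T ^^ n) y) < ?r"
    and close: "dist ((T ^^ n) y) ((T ^^ n) ((T ^^ k) x)) < e"
    unfolding IP_star_set_def by blast
  \<comment> \<open>Commuting the iterates turns the return of \<open>x\<close> at time
    \<open>n\<close> into a return of \<open>(T ^^ k) x\<close>.\<close>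
  have "(T ^^ n) ((T ^^ k) x) = (T ^^ k) ((T ^^ n) x)"
    by (metis add.commute comp_apply funpow_add)
  moreover have "dist ((T ^^ k) x) ((T ^^ k) ((T ^^ n) x)) < e / 2"
    using n(1) xy(1) funpow_in[OF T(2)] by (intro d) auto
  moreover have "dist x y = 3 * e" by (simp add: e_def)
  moreover have "dist x ((T ^^ n) y) < e / 2" "dist y ((T ^^ k) x) < e" using n(2) k by auto
  ultimately show False using close by metric
qed

theorem corollary3p14:
  fixes X :: "'a::metric_space set" and T :: "'a \<Rightarrow> 'a"
  assumes "minimal_system X T"
  shows "pairwise_IP_star_equicontinuous X T \<longleftrightarrow> distal_system X T"
proof
  assume "pairwise_IP_star_equicontinuous X T"
  with assms show "distal_system X T"
    by (rule pairwise_IP_star_equicontinuous_imp_distal)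
next
  have "compact X" "continuous_on X T" "T ` X \<subseteq> X"
    using assms by (simp_all add: minimal_system_def dynamical_system_def)
  moreover assume "distal_system X T"
  ultimately show "pairwise_IP_star_equicontinuous X T"
    by (rule distal_imp_pairwise_IP_star_equicontinuous)
qed

end
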